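(* Let $G$ be a distance-biregular graph with partite sets $V_1,V_2$. For $u\in V_1$ and $w\in V_2$ let $l_i=|G_i(u)|$ and $l_i'=|G_i(w)|$ (these numbers do not depend on the choice of $u\in V_1$ and $w\in V_2$), and let $d_1=\max\{d(x,y):x\in V_1,y\in V(G)\}$ and $d_2=\max\{d(x,y):x\in V_2,y\in V(G)\}$. Put $$q_{11}=\sum_{i=0}^{\lfloor d_1/2\rfloor}2i\,l_{2i},\quad q_{12}=\sum_{i=0}^{\lfloor d_1/2\rfloor}(2i+1)\,l_{2i+1},\quad q_{21}=\sum_{i=0}^{\lfloor d_2/2\rfloor}(2i+1)\,l'_{2i+1},\quad q_{22}=\sum_{i=0}^{\lfloor d_2/2\rfloor}2i\,l'_{2i}.$$ Then the distance spectral radius of $G$ is the larger eigenvalue of the matrix $Q=\begin{pmatrix}q_{11}&q_{12}\\ q_{21}&q_{22}\end{pmatrix}$.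
   Context: All graphs are finite, simple, connected and undirected; $d(x,y)$ denotes graph distance, and $G_i(x)$ is the set of vertices at distance $i$ from $x$ (empty if there are none). The distance matrix $D(G)$ has $(i,j)$ entry equal to the distance between the $i$-th and $j$-th vertices; the distance spectral radius of $G$ is the largest eigenvalue of $D(G)$. A vertex $x$ of a graph $G$ has an intersection array if, for every $i$ from $0$ to the maximum distance from $x$, the numbers of neighbours of $y$ lying in $G_{i-1}(x)$ and in $G_{i+1}(x)$ are the same for all $y\in G_i(x)$; the intersection array of $x$ records these numbers. A connected graph is distance-biregular (DBR) if it is bipartite and all vertices in the same partite set have the same intersection array. *)

theory Defs
  imports
    "Graph_Theory.Digraph_Component"
    "Graph_Theory.Shortest_Path"
    "Jordan_Normal_Form.Spectral_Radius"
begin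

text \<open>
  A finite simple undirected graph is an instance of the locale \<^locale>\<open>graph\<close>: a finite,
  symmetric, loop-free digraph without parallel arcs, each edge being a pair of opposite arcs.
\<close>

definition gdist :: "('a, 'b) pre_digraph \<Rightarrow> 'a \<Rightarrow> 'a \<Rightarrow> nat" where
  "gdist G x y = (LEAST k. \<exists>p. pre_digraph.awalk G x p y \<and> length p = k)"

definition distance_class :: "('a, 'b) pre_digraph \<Rightarrow> 'a \<Rightarrow> nat \<Rightarrow> 'a set" where
  "distance_class G x i = {y \<in> verts G. gdist G x y = i}"

definition max_dist :: "('a, 'b) pre_digraph \<Rightarrow> 'a set \<Rightarrow> nat" where
  "max_dist G S = Max {gdist G x y | x y. x \<in> S \<and> y \<in> verts G}"

definition pred_count :: "('a, 'b) pre_digraph \<Rightarrow> 'a \<Rightarrow> nat \<Rightarrow> 'a \<Rightarrow> nat" where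
  "pred_count G x i y =
     (if i = 0 then 0 else card {z \<in> distance_class G x (i - 1). y \<rightarrow>\<^bsub>G\<^esub> z})"

definition succ_count :: "('a, 'b) pre_digraph \<Rightarrow> 'a \<Rightarrow> nat \<Rightarrow> 'a \<Rightarrow> nat" where
  "succ_count G x i y = card {z \<in> distance_class G x (i + 1). y \<rightarrow>\<^bsub>G\<^esub> z}"

text \<open>
  The array is the list of pairs (neighbours one step closer, neighbours one step further) for
  i from 0 to the maximum distance from x. Every distance class in this range is nonempty in a
  connected graph, so x has at most one intersection array.
\<close>

definition is_intersection_array ::
  "('a, 'b) pre_digraph \<Rightarrow> 'a \<Rightarrow> (nat \<times> nat) list \<Rightarrow> bool" where
  "is_intersection_array G x A \<longleftrightarrow>
     length A = max_dist G {x} + 1 \<and>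
     (\<forall>i \<le> max_dist G {x}. \<forall>y \<in> distance_class G x i.
        A ! i = (pred_count G x i y, succ_count G x i y))"

definition bipartition :: "('a, 'b) pre_digraph \<Rightarrow> 'a set \<Rightarrow> 'a set \<Rightarrow> bool" where
  "bipartition G V1 V2 \<longleftrightarrow>
     V1 \<union> V2 = verts G \<and> V1 \<inter> V2 = {} \<and>
     (\<forall>x y. x \<rightarrow>\<^bsub>G\<^esub> y \<longrightarrow> (x \<in> V1 \<and> y \<in> V2) \<or> (x \<in> V2 \<and> y \<in> V1))"

definition distance_biregular :: "('a, 'b) pre_digraph \<Rightarrow> 'a set \<Rightarrow> 'a set \<Rightarrow> bool" where
  "distance_biregular G V1 V2 \<longleftrightarrow>
     graph G \<and> Digraph_Component.connected G \<and> bipartition G V1 V2 \<and>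
     (\<exists>A. \<forall>x \<in> V1. is_intersection_array G x A) \<and>
     (\<exists>A. \<forall>x \<in> V2. is_intersection_array G x A)"

text \<open>The list \<open>vs\<close> enumerates the vertices; it fixes the order of rows and columns.\<close>

definition distance_matrix :: "('a, 'b) pre_digraph \<Rightarrow> 'a list \<Rightarrow> real mat" where
  "distance_matrix G vs =
     mat (length vs) (length vs) (\<lambda>(i, j). real (gdist G (vs ! i) (vs ! j)))"

definition largest_eigenvalue :: "real mat \<Rightarrow> real" where
  "largest_eigenvalue M = Max (spectrum M)"

definition distance_spectral_radius :: "('a, 'b) pre_digraph \<Rightarrow> 'a list \<Rightarrow> real" where
  "distance_spectral_radius G vs = largest_eigenvalue (distance_matrix G vs)"

text \<open>The distance is the library's shortest-path cost for unit arc weights.\<close>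

lemma gdist_eq_mu:
  assumes "wf_digraph G" and "x \<rightarrow>\<^sup>*\<^bsub>G\<^esub> y"
  shows "ereal (real (gdist G x y)) = wf_digraph.\<mu> G (\<lambda>_. 1) x y"
proof -
  interpret wf_digraph G by fact
  have cost: "awalk_cost (\<lambda>_. 1) p = real (length p)" for p
    by (induction p) simp_all
  obtain p0 where "awalk x p0 y" using assms(2) by (auto simp: reachable_awalk)
  then have "\<exists>k p. awalk x p y \<and> length p = k" by blast
  from LeastI_ex[OF this] obtain p where p: "awalk x p y" "length p = gdist G x y"
    unfolding gdist_def by blast
  have least: "gdist G x y \<le> length q" if "awalk x q y" for q
    unfolding gdist_def by (rule Least_le) (use that in blast)
  show ?thesis
  proof (rule antisym)
    show "ereal (real (gdist G x y)) \<le> \<mu> (\<lambda>_. 1) x y"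
      unfolding \<mu>_def cost by (rule INF_greatest) (simp add: least)
    show "\<mu> (\<lambda>_. 1) x y \<le> ereal (real (gdist G x y))"
      unfolding \<mu>_def cost by (rule INF_lower2[of p]) (simp_all add: p)
  qed
qed

end

theory Submission
  imports Defs
begin

text \<open>
  Double counting the edges between consecutive distance classes turns an intersection array
  into the sizes of these classes. Hence the row of a vertex of the distance matrix, summed over
  either partite set, depends only on the partite set of the vertex: the bipartition is equitable
  with quotient \<open>Q\<close>. As the off-diagonal entries of \<open>Q\<close> are positive, \<open>Q\<close> has a positive
  eigenvector, which lifts to a positive eigenvector of the distance matrix for the same
  eigenvalue. A positive eigenvector of a nonnegative matrix belongs to the largest eigenvalue.
\<close>

section \<open>Positive eigenvectors of nonnegative matrices\<close>

lemma mult_mat_vec_nth_sum: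
  assumes "A \<in> carrier_mat n n" "v \<in> carrier_vec n" "i < n"
  shows "(A *\<^sub>v v) $ i = (\<Sum>j<n. A $$ (i, j) * v $ j)"
  using assms by (simp add: scalar_prod_def lessThan_atLeast0)

text \<open>Perron-type comparison: an eigenvector \<open>z\<close> for \<open>\<mu>\<close> is
  bounded by the least multiple \<open>m\<close> of \<open>f\<close> that dominates it entrywise. In
  a row where the bound is attained, nonnegativity of \<open>A\<close> and the triangle inequality
  give |\<open>\<mu>\<close>| \<le> \<open>\<rho>\<close>.\<close>

lemma eigenvalue_le_positive_eigenvector:
  fixes A :: "real mat"
  assumes A: "A \<in> carrier_mat n n"
    and nonneg: "\<And>i j. i < n \<Longrightarrow> j < n \<Longrightarrow> 0 \<le> A $$ (i, j)"
    and pos: "\<And>i. i < n \<Longrightarrow> 0 < f i"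
    and eig: "\<And>i. i < n \<Longrightarrow> (\<Sum>j<n. A $$ (i, j) * f j) = \<rho> * f i"
    and \<mu>: "eigenvalue A \<mu>"
  shows "\<mu> \<le> \<rho>"
proof -
  from \<mu> A obtain z where z: "z \<in> carrier_vec n" "z \<noteq> 0\<^sub>v n" "A *\<^sub>v z = \<mu> \<cdot>\<^sub>v z"
    unfolding eigenvalue_def eigenvector_def by auto
  obtain k where k: "k < n" "z $ k \<noteq> 0"
    using z(1,2) by (metis carrier_vecD dim_vec eq_vecI index_zero_vec(1) zero_carrier_vec)
  \<comment> \<open>The maximal ratio \<open>m\<close> is the least scaling with |\<open>z\<close>|
    \<le> \<open>m * f\<close>; the index \<open>i\<close> below attains equality.\<close>
  define r where "r i = \<bar>z $ i\<bar> / f i" for i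
  define m where "m = Max (r ` {..<n})"
  have "m \<in> r ` {..<n}" unfolding m_def using k by (intro Max_in) auto
  then obtain i where i: "i < n" "r i = m" by auto
  have le: "r j \<le> m" if "j < n" for j unfolding m_def using that by (intro Max_ge) auto
  have "0 < r k" unfolding r_def using k pos by simp
  \<comment> \<open>Positivity of \<open>m\<close>, from a nonzero entry of \<open>z\<close>, allows
    \<open>m * f i\<close> to be cancelled at the end.\<close>
  with le k have m: "0 < m" by fastforce
  have bound: "\<bar>z $ j\<bar> \<le> m * f j" if "j < n" for j
    using le[OF that] pos[OF that] by (simp add: r_def pos_divide_le_eq)
  have zi: "\<bar>z $ i\<bar> = m * f i"
    using i pos[OF i(1)] by (simp add: r_def field_simps)
  have "\<mu> * z $ i = (\<Sum>j<n. A $$ (i, j) * z $ j)"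
    using mult_mat_vec_nth_sum[OF A z(1) i(1)] z i(1) by simp
  then have "\<bar>\<mu>\<bar> * (m * f i) = \<bar>\<Sum>j<n. A $$ (i, j) * z $ j\<bar>"
    by (metis abs_mult zi)
  also have "\<dots> \<le> (\<Sum>j<n. \<bar>A $$ (i, j) * z $ j\<bar>)" by (rule sum_abs)
  also have "\<dots> \<le> (\<Sum>j<n. A $$ (i, j) * (m * f j))"
    using nonneg i bound by (intro sum_mono) (simp add: abs_mult mult_left_mono)
  also have "\<dots> = m * (\<Sum>j<n. A $$ (i, j) * f j)"
    by (simp add: sum_distrib_left algebra_simps)
  also have "\<dots> = \<rho> * (m * f i)" using eig[OF i(1)] by simp
  finally have "\<bar>\<mu>\<bar> \<le> \<rho>" using m pos[OF i(1)] by simp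
  then show ?thesis by simp
qed

text \<open>The comparison bounds the finite spectrum by \<open>\<rho>\<close>, and \<open>f\<close>
  itself, nonzero because \<open>0 < n\<close>, shows that \<open>\<rho>\<close> belongs to
  it.\<close>

lemma largest_eigenvalue_positive_eigenvector:
  fixes A :: "real mat"
  assumes A: "A \<in> carrier_mat n n" and n: "0 < n"
    and nonneg: "\<And>i j. i < n \<Longrightarrow> j < n \<Longrightarrow> 0 \<le> A $$ (i, j)"
    and pos: "\<And>i. i < n \<Longrightarrow> 0 < f i"
    and eig: "\<And>i. i < n \<Longrightarrow> (\<Sum>j<n. A $$ (i, j) * f j) = \<rho> * f i"
  shows "largest_eigenvalue A = \<rho>"
  unfolding largest_eigenvalue_def
proof (rule Max_eqI)
  show "finite (spectrum A)" using card_finite_spectrum[OF A] by simp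
  show "\<mu> \<le> \<rho>" if "\<mu> \<in> spectrum A" for \<mu>
    using eigenvalue_le_positive_eigenvector[OF A nonneg pos eig] that
    by (simp add: spectrum_def)
  have "A *\<^sub>v vec n f = \<rho> \<cdot>\<^sub>v vec n f"
    using A eig by (intro eq_vecI) (simp_all add: mult_mat_vec_nth_sum[OF A] del: index_mult_mat_vec)
  moreover have "vec n f \<noteq> 0\<^sub>v n"
    using pos[OF n] n by (metis index_vec index_zero_vec(1) less_irrefl)
  ultimately have "eigenvector A (vec n f) \<rho>" using A by (simp add: eigenvector_def)
  then show "\<rho> \<in> spectrum A" by (auto simp: spectrum_def eigenvalue_def)
qed

text \<open>The discriminant of the characteristic polynomial exceeds the square of
  \<open>q11 - q22\<close> by \<open>4 * q12 * q21 > 0\<close>, which makes the eigenvector of the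
  larger root positive.\<close>

lemma positive_eigenvector_2x2:
  fixes q11 q12 q21 q22 :: real
  assumes "0 < q12" "0 < q21"
  obtains a b \<rho> where "0 < a" "0 < b"
    "q11 * a + q12 * b = \<rho> * a" "q21 * a + q22 * b = \<rho> * b"
proof -
  define s where "s = sqrt ((q11 - q22)\<^sup>2 + 4 * q12 * q21)"
  have "\<bar>q11 - q22\<bar> < s"
    unfolding s_def using assms by (intro real_less_rsqrt) simp
  moreover have "s * s = (q11 - q22)\<^sup>2 + 4 * q12 * q21"
    unfolding s_def using assms by simp
  \<comment> \<open>Here \<open>\<rho>\<close> is the larger root, and the first row forces the
    eigenvector to be proportional to (\<open>q12\<close>, \<open>\<rho> - q11\<close>).\<close>
  ultimately show thesis
    using assms(1) by (intro that[of q12 "(q22 - q11 + s) / 2" "(q11 + q22 + s) / 2"])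
      (auto simp: algebra_simps power2_eq_square add_divide_distrib diff_divide_distrib)
qed

section \<open>Distance classes\<close>

context wf_digraph
begin

lemma gdist_le_length: "awalk x p y \<Longrightarrow> gdist G x y \<le> length p"
  unfolding gdist_def by (rule Least_le) blast

text \<open>The \<open>LEAST\<close> in \<open>gdist\<close> is attained only if some walk exists;
  reachability provides one.\<close>

lemma gdist_awalk:
  assumes "x \<rightarrow>\<^sup>* y"
  obtains p where "awalk x p y" "length p = gdist G x y"
proof -
  from assms have "\<exists>k p. awalk x p y \<and> length p = k" by (auto simp: reachable_awalk)
  from LeastI_ex[OF this] that show thesis unfolding gdist_def by blast
qed

lemma gdist_0_iff:
  assumes "x \<rightarrow>\<^sup>* y"
  shows "gdist G x y = 0 \<longleftrightarrow> x = y"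
proof
  assume "gdist G x y = 0"
  with gdist_awalk[OF assms] show "x = y" by (metis awalk_Nil_iff length_0_conv)
next
  assume "x = y"
  with assms have "awalk x [] y" by (auto simp: awalk_Nil_iff reachable_in_verts)
  from gdist_le_length[OF this] show "gdist G x y = 0" by simp
qed

lemma gdist_adj_le:
  assumes "x \<rightarrow>\<^sup>* y" "y \<rightarrow>\<^bsub>G\<^esub> z"
  shows "gdist G x z \<le> Suc (gdist G x y)"
proof -
  obtain p where p: "awalk x p y" "length p = gdist G x y" using gdist_awalk assms(1) by blast
  obtain e where "arc e (y, z)" using assms(2) by (auto simp: arc_def arcs_ends_conv)
  then have "awalk y [e] z" by (auto simp: arc_def awalk_def)
  with p have "awalk x (p @ [e]) z" by (meson awalk_appendI)
  from gdist_le_length[OF this] p show ?thesis by simp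
qed

text \<open>Take the penultimate vertex of a shortest walk: the prefix bounds its distance above by
  \<open>i\<close>, and the last arc bounds it below.\<close>

lemma gdist_Suc_pred:
  assumes "x \<rightarrow>\<^sup>* y" "gdist G x y = Suc i"
  obtains z where "x \<rightarrow>\<^sup>* z" "z \<rightarrow>\<^bsub>G\<^esub> y" "gdist G x z = i"
proof -
  obtain p where p: "awalk x p y" "length p = Suc i" using gdist_awalk assms by metis
  then obtain q e where q: "p = q @ [e]" "length q = i" by (metis length_Suc_conv_rev)
  define z where "z = awlast x q"
  from p q have w: "awalk x q z" "awalk z [e] y" by (auto simp: z_def)
  from w(2) have zy: "z \<rightarrow>\<^bsub>G\<^esub> y" by (auto simp: awalk_simps arcs_ends_conv)
  from w(1) have xz: "x \<rightarrow>\<^sup>* z" by (rule reachable_awalkI)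
  have "gdist G x z = i"
    using gdist_le_length[OF w(1)] gdist_adj_le[OF xz zy] assms(2) q(2) by simp
  with that xz zy show thesis by blast
qed

text \<open>Each arc switches the partite set.\<close>

lemma awalk_parity:
  assumes "bipartition G V1 V2" "awalk x p y"
  shows "(x \<in> V1 \<longleftrightarrow> y \<in> V1) \<longleftrightarrow> even (length p)"
  using assms(2)
proof (induction p arbitrary: x)
  case Nil
  then show ?case by (simp add: awalk_Nil_iff)
next
  case (Cons e p)
  then have "x \<rightarrow>\<^bsub>G\<^esub> head G e" by (auto simp: awalk_Cons_iff arcs_ends_conv)
  with assms(1) have "x \<in> V1 \<longleftrightarrow> head G e \<notin> V1" unfolding bipartition_def by blast
  with Cons show ?case by (auto simp: awalk_Cons_iff)
qed

lemma gdist_parity: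
  assumes "bipartition G V1 V2" "x \<rightarrow>\<^sup>* y"
  shows "(x \<in> V1 \<longleftrightarrow> y \<in> V1) \<longleftrightarrow> even (gdist G x y)"
  using gdist_awalk[OF assms(2)] awalk_parity[OF assms(1)] by metis

end

lemma finite_distance_class: "finite (verts G) \<Longrightarrow> finite (distance_class G x i)"
  by (simp add: distance_class_def)

lemma gdist_le_max_dist:
  assumes "finite (verts G)" "S \<subseteq> verts G" "x \<in> S" "y \<in> verts G"
  shows "gdist G x y \<le> max_dist G S"
proof -
  have "finite S" using assms finite_subset by blast
  have "finite {gdist G x y | x y. x \<in> S \<and> y \<in> verts G}"
    by (rule finite_subset[of _ "(\<lambda>(x, y). gdist G x y) ` (S \<times> verts G)"])
      (use \<open>finite S\<close> assms(1) in auto)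
  then show ?thesis unfolding max_dist_def using assms by (intro Max_ge) auto
qed

section \<open>Class sizes determined by the intersection array\<close>

context graph
begin

text \<open>Both sides count the edges between the two classes, once from the farther class and once
  from the nearer one.\<close>

lemma card_distance_class_Suc:
  assumes A: "is_intersection_array G x A" and x: "x \<in> verts G" and i: "Suc i \<le> max_dist G {x}"
  shows "card (distance_class G x (Suc i)) * fst (A ! Suc i)
    = card (distance_class G x i) * snd (A ! i)"
proof -
  let ?C = "distance_class G x"
  have sym: "y \<rightarrow>\<^bsub>G\<^esub> z \<longleftrightarrow> z \<rightarrow>\<^bsub>G\<^esub> y" for y z using sym_arcs arcs_ends_symmetric by metis
  have p: "card {y \<in> ?C i. z \<rightarrow>\<^bsub>G\<^esub> y} = fst (A ! Suc i)" if "z \<in> ?C (Suc i)" for z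
    using A i that by (auto simp: is_intersection_array_def pred_count_def)
  have s: "card {z \<in> ?C (Suc i). y \<rightarrow>\<^bsub>G\<^esub> z} = snd (A ! i)" if "y \<in> ?C i" for y
    using A i that by (auto simp: is_intersection_array_def succ_count_def)
  have "(\<Sum>y\<in>?C i. card {z \<in> ?C (Suc i). z \<rightarrow>\<^bsub>G\<^esub> y}) = fst (A ! Suc i) * card (?C (Suc i))"
    by (rule sum_multicount) (auto simp: p finite_distance_class)
  moreover have "(\<Sum>y\<in>?C i. card {z \<in> ?C (Suc i). z \<rightarrow>\<^bsub>G\<^esub> y}) = card (?C i) * snd (A ! i)"
    using s by (simp add: sym)
  ultimately show ?thesis by (simp add: mult.commute)
qed

text \<open>A shortest walk reaches \<open>y\<close> through a neighbour one step closer. The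
  positivity is what allows the double-counting identity to be solved for the size of the farther
  class.\<close>

lemma intersection_array_pred_pos:
  assumes A: "is_intersection_array G x A" and i: "Suc i \<le> max_dist G {x}"
    and y: "y \<in> distance_class G x (Suc i)" "x \<rightarrow>\<^sup>* y"
  shows "0 < fst (A ! Suc i)"
proof -
  have "gdist G x y = Suc i" using y(1) by (simp add: distance_class_def)
  then obtain z where z: "x \<rightarrow>\<^sup>* z" "z \<rightarrow>\<^bsub>G\<^esub> y" "gdist G x z = i"
    using gdist_Suc_pred[OF y(2)] by blast
  have "y \<rightarrow>\<^bsub>G\<^esub> z" using z sym_arcs arcs_ends_symmetric by metis
  with z have "z \<in> {z \<in> distance_class G x i. y \<rightarrow>\<^bsub>G\<^esub> z}"
    by (auto simp: distance_class_def reachable_in_verts)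
  moreover have "finite {z \<in> distance_class G x i. y \<rightarrow>\<^bsub>G\<^esub> z}"
    by (simp add: finite_distance_class)
  ultimately have "0 < card {z \<in> distance_class G x i. y \<rightarrow>\<^bsub>G\<^esub> z}"
    unfolding card_gt_0_iff by blast
  then show ?thesis using A i y(1) by (auto simp: is_intersection_array_def pred_count_def)
qed

lemma card_distance_class_cong:
  assumes conn: "strongly_connected G" and verts: "x \<in> verts G" "x' \<in> verts G"
    and A: "is_intersection_array G x A" "is_intersection_array G x' A"
  shows "card (distance_class G x i) = card (distance_class G x' i)"
proof (induction i)
  case 0
  have "distance_class G v 0 = {v}" if "v \<in> verts G" for v
    using that conn gdist_0_iff by (auto simp: distance_class_def)
  then show ?case using verts by simp
next
  case (Suc i)
  \<comment> \<open>The length of the common array fixes the maximum distance.\<close>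
  have eq: "max_dist G {x} = max_dist G {x'}"
    using A by (simp add: is_intersection_array_def)
  show ?case
  proof (cases "Suc i \<le> max_dist G {x}")
    case True
    note i = True True[unfolded eq]
    show ?thesis
    proof (cases "0 < fst (A ! Suc i)")
      case True
      have "card (distance_class G x (Suc i)) * fst (A ! Suc i)
          = card (distance_class G x' (Suc i)) * fst (A ! Suc i)"
        using card_distance_class_Suc[OF A(1) verts(1) i(1)]
          card_distance_class_Suc[OF A(2) verts(2) i(2)] Suc by simp
      with True show ?thesis by simp
    next
      \<comment> \<open>A zero entry is incompatible with a vertex at distance \<open>Suc i\<close>,
        so both classes are empty.\<close>
      case False
      have "distance_class G x (Suc i) = {}"
        using intersection_array_pred_pos[OF A(1) i(1)] False conn verts
        by (fastforce simp: distance_class_def)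
      moreover have "distance_class G x' (Suc i) = {}"
        using intersection_array_pred_pos[OF A(2) i(2)] False conn verts
        by (fastforce simp: distance_class_def)
      ultimately show ?thesis by simp
    qed
  next
    case False
    have "distance_class G v (Suc i) = {}" if "v \<in> verts G" "\<not> Suc i \<le> max_dist G {v}" for v
      using gdist_le_max_dist[of G "{v}" v] that by (fastforce simp: distance_class_def)
    then show ?thesis using False eq verts by simp
  qed
qed

section \<open>Row sums of the distance matrix over a partite set\<close>

lemma sum_gdist_same_part:
  assumes conn: "strongly_connected G" and bip: "bipartition G V1 V2" and x: "x \<in> V1"
    and d: "\<And>y. y \<in> verts G \<Longrightarrow> gdist G x y \<le> d"
  shows "(\<Sum>y\<in>V1. gdist G x y) = (\<Sum>i=0..d div 2. 2 * i * card (distance_class G x (2 * i)))"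
proof -
  have V: "V1 \<subseteq> verts G" using bip by (auto simp: bipartition_def)
  have par: "y \<in> V1 \<longleftrightarrow> even (gdist G x y)" if "y \<in> verts G" for y
    using gdist_parity[OF bip, of x y] conn x V that by blast
  \<comment> \<open>Vertices of \<open>V1\<close> are exactly those at even distance from
    \<open>x\<close>, so grouping by half the distance recovers the even classes.\<close>
  have fib: "{y \<in> V1. gdist G x y div 2 = i} = distance_class G x (2 * i)" for i
    using V par by (fastforce simp: distance_class_def)
  have "(\<Sum>y\<in>V1. gdist G x y)
      = (\<Sum>i=0..d div 2. \<Sum>y\<in>{y \<in> V1. gdist G x y div 2 = i}. gdist G x y)"
    using finite_subset[OF V] by (intro sum.group[symmetric]) (auto intro!: div_le_mono d dest: subsetD[OF V])
  also have "\<dots> = (\<Sum>i=0..d div 2. \<Sum>y\<in>distance_class G x (2 * i). 2 * i)"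
    unfolding fib by (intro sum.cong) (auto simp: distance_class_def)
  finally show ?thesis by (simp add: mult.commute)
qed

text \<open>The vertices of \<open>V2\<close> fill the odd classes. The range up to
  \<open>d div 2\<close> fits either parity of \<open>d\<close>: for even \<open>d\<close> the last
  term concerns distance \<open>d + 1\<close>, where the class is empty.\<close>

lemma sum_gdist_other_part:
  assumes conn: "strongly_connected G" and bip: "bipartition G V1 V2" and x: "x \<in> V1"
    and d: "\<And>y. y \<in> verts G \<Longrightarrow> gdist G x y \<le> d"
  shows "(\<Sum>y\<in>V2. gdist G x y)
    = (\<Sum>i=0..d div 2. (2 * i + 1) * card (distance_class G x (2 * i + 1)))"
proof -
  have V: "V2 \<subseteq> verts G" "V1 \<subseteq> verts G" using bip by (auto simp: bipartition_def)
  have par: "y \<in> V2 \<longleftrightarrow> odd (gdist G x y)" if "y \<in> verts G" for y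
    using gdist_parity[OF bip, of x y] conn x V that bip unfolding bipartition_def by blast
  have fib: "{y \<in> V2. gdist G x y div 2 = i} = distance_class G x (2 * i + 1)" for i
    using V par by (fastforce simp: distance_class_def elim!: oddE)
  have "(\<Sum>y\<in>V2. gdist G x y)
      = (\<Sum>i=0..d div 2. \<Sum>y\<in>{y \<in> V2. gdist G x y div 2 = i}. gdist G x y)"
    using finite_subset[OF V(1)] by (intro sum.group[symmetric]) (auto intro!: div_le_mono d dest: subsetD[OF V(1)])
  also have "\<dots> = (\<Sum>i=0..d div 2. \<Sum>y\<in>distance_class G x (2 * i + 1). 2 * i + 1)"
    unfolding fib by (intro sum.cong) (auto simp: distance_class_def)
  finally show ?thesis by (simp add: mult.commute)
qed

end

lemma bipartition_sym: "bipartition G V1 V2 \<Longrightarrow> bipartition G V2 V1"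
  unfolding bipartition_def by blast

theorem mainTheorem5:
  fixes G :: "('a, 'b) pre_digraph"
    and V1 V2 :: "'a set"
    and u w :: 'a
    and vs :: "'a list"
    and l l' :: "nat \<Rightarrow> nat"
    and d1 d2 :: nat
    and q11 q12 q21 q22 :: real
    and Q :: "real mat"
  assumes "distance_biregular G V1 V2"
    and "distinct vs" and "set vs = verts G"
    and "u \<in> V1" and "w \<in> V2"
    and "l = (\<lambda>i. card (distance_class G u i))"
    and "l' = (\<lambda>i. card (distance_class G w i))"
    and "d1 = max_dist G V1"
    and "d2 = max_dist G V2"
    and "q11 = (\<Sum>i = 0..d1 div 2. real (2 * i * l (2 * i)))"
    and "q12 = (\<Sum>i = 0..d1 div 2. real ((2 * i + 1) * l (2 * i + 1)))"
    and "q21 = (\<Sum>i = 0..d2 div 2. real ((2 * i + 1) * l' (2 * i + 1)))"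
    and "q22 = (\<Sum>i = 0..d2 div 2. real (2 * i * l' (2 * i)))"
    and "Q = mat_of_rows_list 2 [[q11, q12], [q21, q22]]"
  shows "(\<forall>x \<in> V1. \<forall>i. card (distance_class G x i) = l i) \<and>
         (\<forall>x \<in> V2. \<forall>i. card (distance_class G x i) = l' i) \<and>
         distance_spectral_radius G vs = largest_eigenvalue Q"
proof -
  note dbr = assms(1) and vs = assms(2,3) and uw = assms(4,5) and l = assms(6,7)
  interpret graph G using dbr by (simp add: distance_biregular_def)
  \<comment> \<open>Strong connectivity makes every pair of vertices reachable, so that each
    \<open>gdist\<close> is the length of an actual walk.\<close>
  have conn: "strongly_connected G"
    using dbr symmetric_connected_imp_strongly_connected sym_arcs
    by (simp add: distance_biregular_def)
  have bip: "bipartition G V1 V2" using dbr by (simp add: distance_biregular_def)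
  then have V: "V1 \<union> V2 = verts G" "V1 \<inter> V2 = {}" by (auto simp: bipartition_def)
  have fin: "finite V1" "finite V2" using V(1) finite_verts by (metis finite_Un)+
  obtain A1 A2 where A: "\<And>x. x \<in> V1 \<Longrightarrow> is_intersection_array G x A1"
    "\<And>x. x \<in> V2 \<Longrightarrow> is_intersection_array G x A2"
    using dbr by (auto simp: distance_biregular_def)
  have card1: "card (distance_class G x i) = l i" if "x \<in> V1" for x i
    unfolding l using card_distance_class_cong[OF conn _ _ A(1) A(1)] that uw V by blast
  have card2: "card (distance_class G x i) = l' i" if "x \<in> V2" for x i
    unfolding l using card_distance_class_cong[OF conn _ _ A(2) A(2)] that uw V by blast
  have d: "gdist G x y \<le> d1" if "x \<in> V1" "y \<in> verts G" for x y
    using gdist_le_max_dist[of G V1] that V assms(8) by auto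
  have d': "gdist G x y \<le> d2" if "x \<in> V2" "y \<in> verts G" for x y
    using gdist_le_max_dist[of G V2] that V assms(9) by auto
  \<comment> \<open>The bound \<open>d1\<close> is common to all of \<open>V1\<close> and the class
    sizes agree there, so the row sum does not vary with \<open>x\<close>.\<close>
  have q11: "(\<Sum>y\<in>V1. real (gdist G x y)) = q11" if "x \<in> V1" for x
    using arg_cong[OF sum_gdist_same_part[OF conn bip that d[OF that]], of real] card1[OF that]
      assms(10) by simp
  have q12: "(\<Sum>y\<in>V2. real (gdist G x y)) = q12" if "x \<in> V1" for x
    using arg_cong[OF sum_gdist_other_part[OF conn bip that d[OF that]], of real] card1[OF that]
      assms(11) by simp
  \<comment> \<open>Rows of \<open>V2\<close> are handled by exchanging the roles of the partite
    sets.\<close>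
  have q21: "(\<Sum>y\<in>V1. real (gdist G x y)) = q21" if "x \<in> V2" for x
    using arg_cong[OF sum_gdist_other_part[OF conn bipartition_sym[OF bip] that d'[OF that]], of real]
      card2[OF that] assms(12) by simp
  have q22: "(\<Sum>y\<in>V2. real (gdist G x y)) = q22" if "x \<in> V2" for x
    using arg_cong[OF sum_gdist_same_part[OF conn bipartition_sym[OF bip] that d'[OF that]], of real]
      card2[OF that] assms(13) by simp
  have pos_dist: "0 < real (gdist G x y)" if "x \<in> verts G" "y \<in> verts G" "x \<noteq> y" for x y
    using gdist_0_iff[of x y] conn that by auto
  \<comment> \<open>The vertex \<open>w\<close> makes \<open>V2\<close> nonempty, and every vertex
    of \<open>V2\<close> differs from \<open>u\<close>; the sum over \<open>V1\<close> below is
    symmetric.\<close>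
  have "0 < (\<Sum>y\<in>V2. real (gdist G u y))"
    using fin uw V by (intro sum_pos pos_dist) auto
  then have q12_pos: "0 < q12" using q12 uw by simp
  have "0 < (\<Sum>y\<in>V1. real (gdist G w y))"
    using fin uw V by (intro sum_pos pos_dist) auto
  then have q21_pos: "0 < q21" using q21 uw by simp
  have q11_nonneg: "0 \<le> q11" and q22_nonneg: "0 \<le> q22"
    using q11[OF uw(1)] q22[OF uw(2)] by (auto intro: sum_nonneg)
  obtain a b \<rho> where ab: "0 < a" "0 < b"
    "q11 * a + q12 * b = \<rho> * a" "q21 * a + q22 * b = \<rho> * b"
    using positive_eigenvector_2x2[OF q12_pos q21_pos] by blast
  have "largest_eigenvalue Q = \<rho>"
  proof (rule largest_eigenvalue_positive_eigenvector)
    show "Q \<in> carrier_mat 2 2" by (rule carrier_matI) (simp_all add: assms(14) mat_of_rows_list_def)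
    show "0 < (2::nat)" by simp
    show "0 \<le> Q $$ (i, j)" if "i < 2" "j < 2" for i j
      using that assms(14) q11_nonneg q22_nonneg q12_pos q21_pos
      by (auto simp: mat_of_rows_list_def less_2_cases_iff)
    show "0 < (if i = 0 then a else b)" if "i < 2" for i :: nat using ab by simp
    show "(\<Sum>j<2. Q $$ (i, j) * (if j = 0 then a else b)) = \<rho> * (if i = 0 then a else b)"
      if "i < 2" for i
      using that assms(14) ab(3,4)
      by (auto simp: mat_of_rows_list_def less_2_cases_iff numeral_2_eq_2)
  qed
  moreover have "largest_eigenvalue (distance_matrix G vs) = \<rho>"
  proof (rule largest_eigenvalue_positive_eigenvector)
    \<comment> \<open>The eigenvector of \<open>Q\<close> is lifted to be constant on each partite
      set.\<close>
    let ?f = "\<lambda>y. if y \<in> V1 then a else b"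
    show "distance_matrix G vs \<in> carrier_mat (length vs) (length vs)"
      by (simp add: distance_matrix_def)
    show "0 < length vs" using vs uw V by (metis UnI1 length_pos_if_in_set)
    show "0 \<le> distance_matrix G vs $$ (i, j)" if "i < length vs" "j < length vs" for i j
      using that by (simp add: distance_matrix_def)
    show "0 < ?f (vs ! i)" for i using ab by simp
    show "(\<Sum>j<length vs. distance_matrix G vs $$ (i, j) * ?f (vs ! j)) = \<rho> * ?f (vs ! i)"
      if i: "i < length vs" for i
    proof -
      define x where "x = vs ! i"
      have x: "x \<in> V1 \<or> x \<in> V2" using i vs V by (auto simp: x_def)
      have "(\<Sum>j<length vs. distance_matrix G vs $$ (i, j) * ?f (vs ! j))
          = (\<Sum>j<length vs. real (gdist G x (vs ! j)) * ?f (vs ! j))"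
        using i by (simp add: distance_matrix_def x_def)
      \<comment> \<open>Since \<open>vs\<close> lists each vertex exactly once, the sum over indices
        becomes a sum over vertices.\<close>
      also have "\<dots> = (\<Sum>y\<in>verts G. real (gdist G x y) * ?f y)"
        using vs by (intro sum.reindex_bij_betw bij_betw_nth) auto
      also have "\<dots> = (\<Sum>y\<in>V1. real (gdist G x y) * ?f y) + (\<Sum>y\<in>V2. real (gdist G x y) * ?f y)"
        unfolding V(1)[symmetric] using fin V(2) by (rule sum.union_disjoint)
      also have "(\<Sum>y\<in>V1. real (gdist G x y) * ?f y) = (\<Sum>y\<in>V1. real (gdist G x y)) * a"
        by (simp add: sum_distrib_right)
      also have "(\<Sum>y\<in>V2. real (gdist G x y) * ?f y) = (\<Sum>y\<in>V2. real (gdist G x y)) * b"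
        unfolding sum_distrib_right using V(2) by (intro sum.cong) auto
      \<comment> \<open>The row sum has collapsed to one of the two rows of the eigenvector equation
        for \<open>Q\<close>, according to the part containing \<open>x\<close>.\<close>
      finally show ?thesis
        using x V(2) q11 q12 q21 q22 ab(3,4) unfolding x_def[symmetric] by auto
    qed
  qed
  ultimately show ?thesis using card1 card2 by (simp add: distance_spectral_radius_def)
qed

end
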